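(* Let $A\in\mathbb{R}^{n\times n}$, $v,w\in\mathbb{R}^n$, $B=A+vw^T$ satisfy the nonresonance hypothesis, and let $P,Q,R$ be the associated Stein solutions. Assume (S1) $A$ and $B$ each have $n$ distinct complex eigenvalues, all nonzero, and (S2) $P$ and $Q$ are nonsingular. With $G_A,G_B,H,C,\Phi,M,L,K$ as defined in the context and $$\widetilde E=G_A^{-1}\Phi G_A\Phi,$$ one has $$L=I-\widetilde E\qquad\text{and}\qquad I+K=\Phi^{-1}\bigl(G_AM^{-1}\bigr)\Phi .$$ In particular $I+K$ and $I+PQ$ are nonsingular, and $$P^{-1}RQ^{-1}R^T\sim I-\widetilde E,\qquad (I+PQ)^{-1}\sim I-\widetilde E,$$ where $\sim$ denotes similarity over $\mathbb{C}$. Hence the two matrices $P^{-1}RQ^{-1}R^T$ and $(I+PQ)^{-1}$ are similar over $\mathbb{C}$, and therefore over $\mathbb{R}$; in particular they have the same characteristic polynomial.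
   Context: Nonresonance hypothesis: for all complex eigenvalues $\alpha,\alpha'$ of $A$ and $\beta,\beta'$ of $B$ (possibly equal), $\alpha\alpha'\ne1$, $\beta\beta'\neq1$, $\alpha\beta\neq1$. The Stein solutions $P,Q,R\in\mathbb{R}^{n\times n}$ are the unique solutions of $P-APA^T=vv^T$, $Q-B^TQB=ww^T$, $R-ARB=vw^T$. Let $a_1,\dots,a_n$ and $b_1,\dots,b_n$ be the (complex) eigenvalues of $A$ and of $B$, in a fixed order. Define the complex matrices $$G_A=\Bigl[\tfrac{1}{1-a_ia_j}\Bigr]_{i,j=1}^n,\quad G_B=\Bigl[\tfrac{1}{1-b_ib_j}\Bigr]_{i,j=1}^n,\quad H=\Bigl[\tfrac{1}{1-a_ib_j}\Bigr]_{i,j=1}^n,\quad C=\Bigl[\tfrac{1}{b_j-a_i}\Bigr]_{i,j=1}^n,$$ $$\phi_B(z)=\prod_{r=1}^n\frac{z-b_r}{1-b_rz},\qquad \Phi=\operatorname{diag}\bigl(\phi_B(a_1),\dots,\phi_B(a_n)\bigr),$$ $$M=HG_B^{-1}H^T,\qquad L=G_A^{-1}HG_B^{-1}H^T,\qquad K=G_AC^{-T}G_BC^{-1}.$$ Under nonresonance, (S1) and (S2), the spectra of $A$ and $B$ are disjoint, and $G_A,G_B,H,C,\Phi,M$ are well defined and nonsingular. All transposes are plain transposes (no complex conjugation), and $X^{-T}=(X^{-1})^T$. *)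

theory Defs
  imports "Jordan_Normal_Form.Spectral_Radius"
begin

abbreviation cmat :: "real mat \<Rightarrow> complex mat" where
  "cmat \<equiv> map_mat complex_of_real"

(* Unspecified if X is singular; under the hypotheses of the theorem every matrix
   inverted below is nonsingular. *)
definition minv :: "'a :: field mat \<Rightarrow> 'a mat" where
  "minv X = the (mat_inverse X)"

(* v w\<^sup>T *)
definition outer :: "'a :: times vec \<Rightarrow> 'a vec \<Rightarrow> 'a mat" where
  "outer v w = mat (dim_vec v) (dim_vec w) (\<lambda>(i, j). v $ i * w $ j)"

definition nonresonant :: "real mat \<Rightarrow> real mat \<Rightarrow> bool" where
  "nonresonant A B \<longleftrightarrow>
     (\<forall>\<alpha>\<in>spectrum (cmat A). \<forall>\<alpha>'\<in>spectrum (cmat A).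
      \<forall>\<beta>\<in>spectrum (cmat B). \<forall>\<beta>'\<in>spectrum (cmat B).
        \<alpha> * \<alpha>' \<noteq> 1 \<and> \<beta> * \<beta>' \<noteq> 1 \<and> \<alpha> * \<beta> \<noteq> 1)"

(* Below, a i and b i with i < n are the eigenvalues of A and B; the indices start at 0.
   No complex conjugation occurs: all transposes are plain. *)

definition GA_mat :: "nat \<Rightarrow> (nat \<Rightarrow> complex) \<Rightarrow> complex mat" where
  "GA_mat n a = mat n n (\<lambda>(i, j). 1 / (1 - a i * a j))"

definition GB_mat :: "nat \<Rightarrow> (nat \<Rightarrow> complex) \<Rightarrow> complex mat" where
  "GB_mat n b = mat n n (\<lambda>(i, j). 1 / (1 - b i * b j))"

definition H_mat :: "nat \<Rightarrow> (nat \<Rightarrow> complex) \<Rightarrow> (nat \<Rightarrow> complex) \<Rightarrow> complex mat" where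
  "H_mat n a b = mat n n (\<lambda>(i, j). 1 / (1 - a i * b j))"

definition C_mat :: "nat \<Rightarrow> (nat \<Rightarrow> complex) \<Rightarrow> (nat \<Rightarrow> complex) \<Rightarrow> complex mat" where
  "C_mat n a b = mat n n (\<lambda>(i, j). 1 / (b j - a i))"

definition phi_B :: "nat \<Rightarrow> (nat \<Rightarrow> complex) \<Rightarrow> complex \<Rightarrow> complex" where
  "phi_B n b z = (\<Prod>r<n. (z - b r) / (1 - b r * z))"

definition Phi_mat :: "nat \<Rightarrow> (nat \<Rightarrow> complex) \<Rightarrow> (nat \<Rightarrow> complex) \<Rightarrow> complex mat" where
  "Phi_mat n a b = mat_diag n (\<lambda>i. phi_B n b (a i))"

definition M_mat :: "nat \<Rightarrow> (nat \<Rightarrow> complex) \<Rightarrow> (nat \<Rightarrow> complex) \<Rightarrow> complex mat" where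
  "M_mat n a b = H_mat n a b * minv (GB_mat n b) * transpose_mat (H_mat n a b)"

definition L_mat :: "nat \<Rightarrow> (nat \<Rightarrow> complex) \<Rightarrow> (nat \<Rightarrow> complex) \<Rightarrow> complex mat" where
  "L_mat n a b =
     minv (GA_mat n a) * H_mat n a b * minv (GB_mat n b) * transpose_mat (H_mat n a b)"

definition K_mat :: "nat \<Rightarrow> (nat \<Rightarrow> complex) \<Rightarrow> (nat \<Rightarrow> complex) \<Rightarrow> complex mat" where
  "K_mat n a b =
     GA_mat n a * transpose_mat (minv (C_mat n a b)) * GB_mat n b * minv (C_mat n a b)"

definition E_mat :: "nat \<Rightarrow> (nat \<Rightarrow> complex) \<Rightarrow> (nat \<Rightarrow> complex) \<Rightarrow> complex mat" where
  "E_mat n a b = minv (GA_mat n a) * Phi_mat n a b * GA_mat n a * Phi_mat n a b"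

end

theory Submission
  imports Defs
begin

text \<open>
  Diagonalize \<open>A = S D\<^sub>a S\<^sup>-\<^sup>1\<close> and \<open>B = T D\<^sub>b T\<^sup>-\<^sup>1\<close>, and let \<open>X\<close> and \<open>Y\<close> be the diagonal matrices
  of \<open>S\<^sup>-\<^sup>1 v\<close> and \<open>T\<^sup>T w\<close>. The Stein equations become entrywise, so \<open>P = S X G\<^sub>A X S\<^sup>T\<close>,
  \<open>Q = T\<^sup>-\<^sup>T Y G\<^sub>B Y T\<^sup>-\<^sup>1\<close> and \<open>R = S X H Y T\<^sup>-\<^sup>1\<close>, while \<open>B = A + v w\<^sup>T\<close> gives \<open>S\<^sup>-\<^sup>1 T = X C Y\<close>.
  Hence \<open>P\<^sup>-\<^sup>1 R Q\<^sup>-\<^sup>1 R\<^sup>T\<close> is similar to \<open>L\<close> and \<open>P Q\<close> to \<open>K\<close>.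

  Let \<open>D\<close> be the diagonal matrix of the derivatives of \<open>\<phi>\<^sub>B\<close> at the \<open>b\<^sub>k\<close>. Lagrange interpolation
  of the polynomials \<open>\<Prod>\<^sub>r\<^sub>\<noteq>\<^sub>j (1 - b\<^sub>r z)\<close> at the \<open>b\<^sub>k\<close> yields both \<open>G\<^sub>B D\<^sup>-\<^sup>1 G\<^sub>B = D\<close> and
  \<open>H = - \<Phi> C D\<^sup>-\<^sup>1 G\<^sub>B\<close>, so \<open>M = \<Phi> C G\<^sub>B\<^sup>-\<^sup>1 C\<^sup>T \<Phi>\<close>. Since \<open>M\<close> is also the Pick matrix
  \<open>G\<^sub>A - \<Phi> G\<^sub>A \<Phi>\<close>, both matrix identities follow, and \<open>(I + K)\<^sup>-\<^sup>1 = \<Phi>\<^sup>-\<^sup>1 M G\<^sub>A\<^sup>-\<^sup>1 \<Phi>\<close> is similar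
  to \<open>G\<^sub>A\<^sup>-\<^sup>1 M = L\<close>.
\<close>

subsection \<open>Interpolation identities for the Blaschke product\<close>

text \<open>The derivative of \<open>\<phi>\<^sub>B\<close> at its zero \<open>b\<^sub>k\<close>.\<close>

definition phi_B_deriv :: "nat \<Rightarrow> (nat \<Rightarrow> complex) \<Rightarrow> nat \<Rightarrow> complex" where
  "phi_B_deriv n b k = (\<Prod>r\<in>{..<n} - {k}. b k - b r) / (\<Prod>r<n. 1 - b r * b k)"

lemma degree_prod_linear_le:
  fixes f g :: "'b \<Rightarrow> 'a :: idom"
  assumes "finite I"
  shows "degree (\<Prod>r\<in>I. [:f r, g r:]) \<le> card I"
proof -
  have "degree (\<Prod>r\<in>I. [:f r, g r:]) \<le> sum (degree \<circ> (\<lambda>r. [:f r, g r:])) I"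
    using assms by (rule degree_prod_sum_le)
  also have "\<dots> \<le> (\<Sum>r\<in>I. 1)" by (intro sum_mono) simp
  finally show ?thesis by simp
qed

lemma prod_remove_eq_divide:
  fixes f :: "nat \<Rightarrow> 'a :: field"
  assumes "k < n" "f k \<noteq> 0"
  shows "(\<Prod>r\<in>{..<n} - {k}. f r) = (\<Prod>r<n. f r) / f k"
  using assms prod.remove[of "{..<n}" k f] by simp

lemma phi_B_deriv_nonzero:
  assumes "inj_on b {..<n}" "\<And>i j. i < n \<Longrightarrow> j < n \<Longrightarrow> b i * b j \<noteq> 1" "k < n"
  shows "phi_B_deriv n b k \<noteq> 0"
  using assms by (auto simp: phi_B_deriv_def inj_on_def)

text \<open>Both sides are polynomials in \<open>z\<close> of degree less than \<open>n\<close>, so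
  comparing them at the \<open>n\<close> distinct nodes \<open>b i\<close> suffices. At
  \<open>b i\<close> only the term \<open>k = i\<close> survives; its coefficient is the value of
  the left side there divided by the product of the differences \<open>b i - b r\<close> over
  \<open>r\<close> other than \<open>i\<close>.\<close>

lemma lagrange_blaschke:
  fixes b :: "nat \<Rightarrow> complex"
  assumes inj: "inj_on b {..<n}" and bb: "\<And>i j. i < n \<Longrightarrow> j < n \<Longrightarrow> b i * b j \<noteq> 1"
    and j: "j < n"
  shows "(\<Prod>r\<in>{..<n} - {j}. 1 - b r * z) =
    (\<Sum>k<n. 1 / (1 - b k * b j) / phi_B_deriv n b k * (\<Prod>r\<in>{..<n} - {k}. z - b r))"
proof -
  define p where "p = (\<Prod>r\<in>{..<n} - {j}. [:1, - b r:])"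
  define q where "q = (\<Sum>k<n. Polynomial.smult (1 / (1 - b k * b j) / phi_B_deriv n b k)
    (\<Prod>r\<in>{..<n} - {k}. [:- b r, 1:]))"
  have card: "card (b ` {..<n}) = n" using card_image[OF inj] by simp
  have p: "poly p z = (\<Prod>r\<in>{..<n} - {j}. 1 - b r * z)" for z
    by (simp add: p_def poly_prod mult.commute)
  have q: "poly q z = (\<Sum>k<n. 1 / (1 - b k * b j) / phi_B_deriv n b k * (\<Prod>r\<in>{..<n} - {k}. z - b r))" for z
    by (simp add: q_def poly_prod poly_sum)
  have degp: "degree p < n"
    using degree_prod_linear_le[of "{..<n} - {j}" "\<lambda>r. 1" "\<lambda>r. - b r"] j by (simp add: p_def)
  have "degree (\<Prod>r\<in>{..<n} - {k}. [:- b r, 1:]) < n" if "k < n" for k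
    using degree_prod_linear_le[of "{..<n} - {k}" "\<lambda>r. - b r" "\<lambda>r. 1"] that by simp
  then have degq: "degree q < n"
    unfolding q_def using j
    by (intro degree_sum_less le_less_trans[OF degree_smult_le]) auto
  have "poly p (b i) = poly q (b i)" if i: "i < n" for i
  proof -
    have zero: "(\<Prod>r\<in>{..<n} - {k}. b i - b r) = 0" if "k < n" "k \<noteq> i" for k
      using that i by (auto intro!: prod_zero)
    have "poly q (b i) = (\<Sum>k<n. if k = i then 1 / (1 - b i * b j) / phi_B_deriv n b i * (\<Prod>r\<in>{..<n} - {i}. b i - b r) else 0)"
      unfolding q by (intro sum.cong) (auto simp: zero)
    also have "\<dots> = 1 / (1 - b i * b j) / phi_B_deriv n b i * (\<Prod>r\<in>{..<n} - {i}. b i - b r)"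
      using i by simp
    also have "\<dots> = (\<Prod>r<n. 1 - b r * b i) / (1 - b j * b i)"
      using phi_B_deriv_nonzero[OF inj bb i] by (simp add: phi_B_deriv_def mult.commute)
    also have "\<dots> = poly p (b i)"
      unfolding p using bb[OF j i] j by (simp add: prod_remove_eq_divide)
    finally show ?thesis by simp
  qed
  then have "p = q" using degp degq card by (intro poly_eqI_degree[of "b ` {..<n}"]) auto
  then show ?thesis using p q by metis
qed

text \<open>After clearing denominators both sides are polynomials in \<open>z\<close> of degree at most \<open>n\<close>
  that agree at the \<open>n + 1\<close> points \<open>b\<^sub>1, \<dots>, b\<^sub>n, 1 / u\<close>.\<close>

lemma pick_expansion:
  fixes b c :: "nat \<Rightarrow> complex"
  assumes inj: "inj_on b {..<n}" and bb: "\<And>i j. i < n \<Longrightarrow> j < n \<Longrightarrow> b i * b j \<noteq> 1"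
    and u: "u \<noteq> 0" "\<And>i. i < n \<Longrightarrow> u * b i \<noteq> 1"
    and z: "\<And>i. i < n \<Longrightarrow> z * b i \<noteq> 1" "z * u \<noteq> 1"
    and c: "\<And>i. i < n \<Longrightarrow> (\<Sum>k<n. c k / (1 - b k * b i)) = 1 / (1 - u * b i)"
  shows "(\<Sum>k<n. c k / (1 - z * b k)) = (1 - phi_B n b z * phi_B n b u) / (1 - z * u)"
proof -
  \<comment> \<open>As functions of \<open>z\<close>, \<open>p\<close> is
    \<open>1 - phi_B n b u * phi_B n b z\<close> and \<open>q\<close> is \<open>1 - u * z\<close>
    times the sum over \<open>k\<close>, each multiplied by the product of all
    \<open>1 - b r * z\<close>.\<close>
  define p where "p = (\<Prod>r<n. [:1, - b r:]) - Polynomial.smult (phi_B n b u) (\<Prod>r<n. [:- b r, 1:])"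
  define q where "q = [:1, - u:] * (\<Sum>k<n. Polynomial.smult (c k) (\<Prod>r\<in>{..<n} - {k}. [:1, - b r:]))"
  have p: "poly p z = (\<Prod>r<n. 1 - b r * z) - phi_B n b u * (\<Prod>r<n. z - b r)" for z
    by (simp add: p_def poly_prod mult.commute)
  have q: "poly q z = (1 - u * z) * (\<Sum>k<n. c k * (\<Prod>r\<in>{..<n} - {k}. 1 - b r * z))" for z
    unfolding q_def poly_mult poly_sum poly_smult poly_prod by (simp add: mult.commute)
  have q': "poly q z = (1 - u * z) * ((\<Prod>r<n. 1 - b r * z) * (\<Sum>k<n. c k / (1 - b k * z)))"
    if "\<And>i. i < n \<Longrightarrow> b i * z \<noteq> 1" for z
    unfolding q using that
    by (auto simp: sum_distrib_left prod_remove_eq_divide intro!: arg_cong[where f = "\<lambda>x. _ * x"] sum.cong)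
  have inv: "1 / u \<notin> b ` {..<n}" using u by (auto simp: field_simps)
  have card: "card (insert (1 / u) (b ` {..<n})) = Suc n"
    using card_image[OF inj] inv by simp
  have "degree p \<le> n" unfolding p_def
    using degree_prod_linear_le[of "{..<n}" "\<lambda>r. - b r" "\<lambda>r. 1"]
      degree_prod_linear_le[of "{..<n}" "\<lambda>r. 1" "\<lambda>r. - b r"]
    by (intro degree_diff_le order.trans[OF degree_smult_le]) auto
  moreover have "degree q \<le> n"
  \<comment> \<open>The bound \<open>n - 1\<close> is truncated at \<open>n = 0\<close>; in that
    case the sum is empty and \<open>q\<close> is zero.\<close>
  proof (cases "n = 0")
    case False
    have "degree (\<Sum>k<n. Polynomial.smult (c k) (\<Prod>r\<in>{..<n} - {k}. [:1, - b r:])) \<le> n - 1"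
    proof (intro degree_sum_le order.trans[OF degree_smult_le])
      fix k assume "k \<in> {..<n}"
      then show "degree (\<Prod>r\<in>{..<n} - {k}. [:1, - b r:]) \<le> n - 1"
        using degree_prod_linear_le[of "{..<n} - {k}" "\<lambda>r. 1" "\<lambda>r. - b r"] by simp
    qed simp
    moreover have "degree [:1, - u:] \<le> 1" by simp
    ultimately show ?thesis
      unfolding q_def using degree_mult_le[of "[:1, - u:]"] False
      by (smt (verit, best) One_nat_def Suc_pred add.commute add_mono le_trans not_gr_zero plus_1_eq_Suc)
  qed (simp add: q_def)
  moreover have "poly p x = poly q x" if x: "x \<in> insert (1 / u) (b ` {..<n})" for x
  proof (cases "x = 1 / u")
    case True
    \<comment> \<open>Up to the common factor \<open>1 / u ^ n\<close>, the two products in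
      \<open>p\<close> at \<open>1 / u\<close> are the numerator and the denominator of
      \<open>phi_B n b u\<close>, so \<open>p\<close> vanishes there; \<open>q\<close> vanishes
      through its factor \<open>1 - u * z\<close>.\<close>
    have "(\<Prod>r<n. 1 - b r / u) = (\<Prod>r<n. (u - b r) * (1 / u))"
      and "(\<Prod>r<n. 1 / u - b r) = (\<Prod>r<n. (1 - b r * u) * (1 / u))"
      using u(1) by (auto simp: field_simps intro!: prod.cong)
    moreover have "(\<Prod>r<n. 1 - b r * u) \<noteq> 0" using u(2) by (auto simp: mult.commute)
    ultimately have "poly p x = 0"
      unfolding p True phi_B_def by (simp add: prod_dividef prod.distrib)
    then show ?thesis using u(1) by (simp add: q True)
  next
    case False
    then obtain i where i: "i < n" "x = b i" using x by auto
    \<comment> \<open>At a node the second product of \<open>p\<close> drops out, while the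
      hypothesis on \<open>c\<close> cancels the factor \<open>1 - u * b i\<close> of
      \<open>q\<close>.\<close>
    have "(\<Prod>r<n. b i - b r) = 0" using i by (auto intro!: prod_zero)
    then have "poly p x = (\<Prod>r<n. 1 - b r * b i)" by (simp add: p i)
    also have "\<dots> = poly q x"
      using bb i u(2)[of i] by (simp add: q' c)
    finally show ?thesis .
  qed
  ultimately have "p = q"
    using card by (intro poly_eqI_degree[of "insert (1 / u) (b ` {..<n})"]) auto
  then have "poly p z = poly q z" by simp
  moreover have nz: "(\<Prod>r<n. 1 - b r * z) \<noteq> 0" using z(1) by (auto simp: mult.commute)
  moreover have "(\<Prod>r<n. z - b r) = phi_B n b z * (\<Prod>r<n. 1 - b r * z)"
    using nz by (simp add: phi_B_def prod_dividef)
  ultimately have "(1 - phi_B n b u * phi_B n b z) * (\<Prod>r<n. 1 - b r * z) =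
      (1 - u * z) * (\<Sum>k<n. c k / (1 - b k * z)) * (\<Prod>r<n. 1 - b r * z)"
    using z(1) by (subst (asm) q') (auto simp: p mult.commute algebra_simps)
  then have "1 - phi_B n b u * phi_B n b z = (1 - u * z) * (\<Sum>k<n. c k / (1 - b k * z))"
    using nz by simp
  then show ?thesis using z(2) by (simp add: field_simps)
qed

subsection \<open>Inverses, similarity and diagonalization\<close>

lemma det_nonzero_if_inverse:
  fixes X :: "'a :: field mat"
  assumes "X \<in> carrier_mat n n" "Y \<in> carrier_mat n n" "X * Y = 1\<^sub>m n"
  shows "det X \<noteq> 0"
  using det_mult[OF assms(1,2)] assms(3) by auto

text \<open>\<open>mat_inverse\<close> returns \<open>None\<close> only for a matrix that is not a
  unit, which a nonzero determinant rules out.\<close>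

lemma minv_inverse:
  fixes X :: "'a :: field mat"
  assumes X: "X \<in> carrier_mat n n" and det: "det X \<noteq> 0"
  shows "minv X \<in> carrier_mat n n" "X * minv X = 1\<^sub>m n" "minv X * X = 1\<^sub>m n"
proof -
  obtain Y where "mat_inverse X = Some Y"
    using mat_inverse(1)[OF X, of "()"] det_non_zero_imp_unit[OF X det, of "()"]
    by (cases "mat_inverse X") auto
  with mat_inverse(2)[OF X this]
  show "minv X \<in> carrier_mat n n" "X * minv X = 1\<^sub>m n" "minv X * X = 1\<^sub>m n"
    by (auto simp: minv_def)
qed

lemma invertible_mat_iff_det:
  fixes X :: "'a :: field mat"
  assumes X: "X \<in> carrier_mat n n"
  shows "invertible_mat X \<longleftrightarrow> det X \<noteq> 0"
proof
  assume "invertible_mat X"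
  then obtain Y where XY: "X * Y = 1\<^sub>m (dim_row X)" and YX: "Y * X = 1\<^sub>m (dim_row Y)"
    by (auto simp: invertible_mat_def inverts_mat_def)
  \<comment> \<open>\<open>inverts_mat\<close> does not fix the dimensions of \<open>Y\<close>; they
    are read off from the two product equations.\<close>
  have "dim_col Y = n" using arg_cong[OF XY, of dim_col] X by simp
  moreover have "dim_row Y = n" using arg_cong[OF YX, of dim_col] X by simp
  ultimately have "Y \<in> carrier_mat n n" by auto
  then show "det X \<noteq> 0" using det_nonzero_if_inverse[OF X] XY X by simp
next
  assume "det X \<noteq> 0"
  from minv_inverse[OF X this] show "invertible_mat X"
    using X by (auto simp: invertible_mat_def inverts_mat_def)
qed

lemma minv_eqI:
  fixes X :: "'a :: field mat"
  assumes X: "X \<in> carrier_mat n n" and Y: "Y \<in> carrier_mat n n" and XY: "X * Y = 1\<^sub>m n"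
  shows "minv X = Y"
proof -
  note inv = minv_inverse[OF X det_nonzero_if_inverse[OF X Y XY]]
  have "minv X = minv X * (X * Y)" using inv XY by simp
  also have "\<dots> = (minv X * X) * Y" using X Y inv(1) by (simp add: assoc_mult_mat[of _ n n _ n _ n])
  finally show ?thesis using inv Y by simp
qed

text \<open>Serves as a rewrite rule: once products are associated to the right, an adjacent pair of
  inverse factors is followed by a remainder \<open>Z\<close>.\<close>

lemma mult_inverse_cancel:
  assumes "X * Y = 1\<^sub>m n" "X \<in> carrier_mat n n" "Y \<in> carrier_mat n n" "Z \<in> carrier_mat n n"
  shows "X * (Y * Z) = (Z :: 'a :: semiring_1 mat)"
  using assms by (simp flip: assoc_mult_mat[of X n n Y n Z n])

lemma det_mat_diag: "det (mat_diag n f) = (\<Prod>i<n. f i :: 'a :: comm_ring_1)"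
proof -
  have "det (mat_diag n f) = prod_list (diag_mat (mat_diag n f))"
    by (rule det_upper_triangular[of _ n]) (auto simp: mat_diag_def)
  also have "\<dots> = (\<Prod>i<n. f i)"
    by (simp add: prod_list_diag_prod mat_diag_def atLeast0LessThan)
  finally show ?thesis .
qed

lemma transpose_mat_diag [simp]: "transpose_mat (mat_diag n f) = mat_diag n f"
  by (auto simp: mat_diag_def)

lemma similar_mat_trans_sym:
  assumes "similar_mat X Z" "similar_mat Y Z"
  shows "similar_mat X (Y :: 'a :: semiring_1 mat)"
  using assms similar_mat_sym similar_mat_trans by blast

text \<open>If \<open>S = U + \<i> V\<close> intertwines two real matrices, so does \<open>U + t V\<close> for every real \<open>t\<close>;
  as \<open>det (U + t V)\<close> is a polynomial in \<open>t\<close> that is nonzero at \<open>\<i>\<close>, some real \<open>t\<close> works.\<close>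

lemma similar_mat_real_if_complex:
  assumes sim: "similar_mat (cmat X) (cmat Y)"
  shows "similar_mat X Y"
proof -
  from similar_matD[OF sim] obtain n S T where
    car: "{cmat X, cmat Y, S, T} \<subseteq> carrier_mat n n" and
    inv: "S * T = 1\<^sub>m n" "T * S = 1\<^sub>m n" and eq: "cmat X = S * cmat Y * T" by blast
  have X: "X \<in> carrier_mat n n" and Y: "Y \<in> carrier_mat n n" using car by auto
  have S: "S \<in> carrier_mat n n" and T: "T \<in> carrier_mat n n" using car by auto
  have "cmat X * S = S * cmat Y * (T * S)"
    unfolding eq using car
    by (simp add: assoc_mult_mat[of _ n n _ n _ n] mult_carrier_mat[of _ n n _ n])
  then have XS: "cmat X * S = S * cmat Y" using inv S Y by simp
  \<comment> \<open>\<open>X\<close> and \<open>Y\<close> are real, so the intertwining relation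
    splits into its real and imaginary parts.\<close>
  define U where "U = map_mat Re S"
  define V where "V = map_mat Im S"
  have U: "U \<in> carrier_mat n n" and V: "V \<in> carrier_mat n n" using S by (auto simp: U_def V_def)
  have XU: "X * U = U * Y"
  proof (rule eq_matI)
    fix i j assume "i < dim_row (U * Y)" "j < dim_col (U * Y)"
    then have ij: "i < n" "j < n" using U Y by auto
    have "Re ((cmat X * S) $$ (i, j)) = Re ((S * cmat Y) $$ (i, j))" using XS by simp
    then show "(X * U) $$ (i, j) = (U * Y) $$ (i, j)"
      using ij S X Y by (simp add: U_def scalar_prod_def)
  qed (use X Y U in auto)
  have XV: "X * V = V * Y"
  proof (rule eq_matI)
    fix i j assume "i < dim_row (V * Y)" "j < dim_col (V * Y)"
    then have ij: "i < n" "j < n" using V Y by auto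
    have "Im ((cmat X * S) $$ (i, j)) = Im ((S * cmat Y) $$ (i, j))" using XS by simp
    then show "(X * V) $$ (i, j) = (V * Y) $$ (i, j)"
      using ij S X Y by (simp add: V_def scalar_prod_def)
  qed (use X Y V in auto)
  define p where "p = det (mat n n (\<lambda>(i, j). [:complex_of_real (U $$ (i, j)), complex_of_real (V $$ (i, j)):]))"
  have p: "poly p t = det (mat n n (\<lambda>(i, j). complex_of_real (U $$ (i, j)) + t * complex_of_real (V $$ (i, j))))" for t
    unfolding p_def by (rule poly_det_cong[of _ n]) auto
  have "mat n n (\<lambda>(i, j). complex_of_real (U $$ (i, j)) + \<i> * complex_of_real (V $$ (i, j))) = S"
    using S by (auto simp: U_def V_def complex_eq_iff)
  then have "poly p \<i> \<noteq> 0" using p det_nonzero_if_inverse[OF S T inv(1)] by simp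
  then have "p \<noteq> 0" by auto
  then have "finite {z. poly p z = 0}" by (rule poly_roots_finite)
  moreover have "infinite (range complex_of_real)"
    using infinite_UNIV_char_0 by (auto simp: finite_image_iff inj_on_def)
  ultimately obtain t :: real where t: "poly p (complex_of_real t) \<noteq> 0"
    by (metis (mono_tags, lifting) finite_subset image_subset_iff mem_Collect_eq)
  define W where "W = U + t \<cdot>\<^sub>m V"
  have W: "W \<in> carrier_mat n n" using U V by (simp add: W_def)
  have "cmat W = mat n n (\<lambda>(i, j). complex_of_real (U $$ (i, j)) + complex_of_real t * complex_of_real (V $$ (i, j)))"
    using U V by (auto simp: W_def)
  then have "det (cmat W) \<noteq> 0" using t p by simp
  then have det: "det W \<noteq> 0" by simp
  note Wi = minv_inverse[OF W det]
  have "X * W = W * Y"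
    unfolding W_def using X Y U V XU XV
    by (simp add: mult_add_distrib_mat[of _ n n _ n] add_mult_distrib_mat[of _ n n _ _ n]
        mult_smult_distrib[of _ n n _ n] mult_smult_assoc_mat[of _ n n _ n])
  moreover have "X * W * minv W = X"
    using W X Wi by (simp add: assoc_mult_mat[of _ n n _ n _ n])
  ultimately have "X = W * Y * minv W" by simp
  then show ?thesis
    using W X Y Wi by (intro similar_matI[of _ _ W "minv W" n]) auto
qed

section \<open>Eigenbases of matrices with distinct eigenvalues\<close>

lemma distinct_eigenvectors_independent:
  fixes X :: "'a :: field mat"
  assumes X: "X \<in> carrier_mat n n" and fin: "finite I"
    and ev: "\<And>i. i \<in> I \<Longrightarrow> eigenvector X (s i) (a i)"
    and inj: "inj_on a I"
    and zero: "\<And>k. k < n \<Longrightarrow> (\<Sum>i\<in>I. c i * s i $ k) = 0"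
    and i: "i \<in> I"
  shows "c i = 0"
  using fin ev inj zero i
proof (induction I arbitrary: c i rule: finite_induct)
  case (insert m I)
  have s: "s i \<in> carrier_vec n" "X *\<^sub>v s i = a i \<cdot>\<^sub>v s i" "s i \<noteq> 0\<^sub>v n" if "i \<in> insert m I" for i
    using insert.prems(1)[OF that] X by (auto simp: eigenvector_def)
  have entry: "(\<Sum>l<n. X $$ (k, l) * s i $ l) = a i * s i $ k" if "k < n" "i \<in> insert m I" for k i
    using arg_cong[OF s(2)[OF that(2)], of "\<lambda>v. v $ k"] s(1)[OF that(2)] X that(1)
    by (simp add: scalar_prod_def atLeast0LessThan)
  \<comment> \<open>Applying \<open>X\<close> to the linear relation and subtracting
    \<open>a m\<close> times the relation removes the term of \<open>m\<close> and scales every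
    other term by the nonzero number \<open>a i - a m\<close>. The induction hypothesis applies to
    this shorter relation.\<close>
  have "(\<Sum>i\<in>I. (c i * (a i - a m)) * s i $ k) = 0" if k: "k < n" for k
  proof -
    have "(\<Sum>i\<in>insert m I. c i * (a i * s i $ k)) = (\<Sum>i\<in>insert m I. c i * (\<Sum>l<n. X $$ (k, l) * s i $ l))"
      using entry[OF k] by (intro sum.cong) auto
    also have "\<dots> = (\<Sum>i\<in>insert m I. \<Sum>l<n. X $$ (k, l) * (c i * s i $ l))"
      by (simp only: sum_distrib_left mult.left_commute)
    also have "\<dots> = (\<Sum>l<n. \<Sum>i\<in>insert m I. X $$ (k, l) * (c i * s i $ l))"
      by (rule sum.swap)
    also have "\<dots> = (\<Sum>l<n. X $$ (k, l) * (\<Sum>i\<in>insert m I. c i * s i $ l))"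
      by (simp only: sum_distrib_left)
    also have "\<dots> = 0" using insert.prems(3) by (intro sum.neutral) auto
    finally have "(\<Sum>i\<in>insert m I. c i * (a i * s i $ k)) - a m * (\<Sum>i\<in>insert m I. c i * s i $ k) = 0"
      using insert.prems(3)[OF k] by simp
    then have "(\<Sum>i\<in>insert m I. (c i * (a i - a m)) * s i $ k) = 0"
      by (simp add: sum_distrib_left sum_subtractf[symmetric] algebra_simps del: sum.insert)
    then show ?thesis using insert.hyps by simp
  qed
  then have "c i * (a i - a m) = 0" if "i \<in> I" for i
    using insert.IH[of "\<lambda>i. c i * (a i - a m)" i] insert.prems(1,2) that by auto
  then have cI: "c i = 0" if "i \<in> I" for i
    using that insert.prems(2) insert.hyps(2) by (auto simp: inj_on_def)
  have "c m = 0"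
  proof (rule ccontr)
    assume cm: "c m \<noteq> 0"
    have "s m $ k = 0" if "k < n" for k
      using insert.prems(3)[OF that] insert.hyps cI cm by simp
    then have "s m = 0\<^sub>v n" using s(1)[of m] by (intro eq_vecI) auto
    then show False using s(3) by simp
  qed
  then show ?case using cI insert.prems(4) by auto
qed simp

text \<open>The bijection encodes that \<open>X\<close> has \<open>n\<close> distinct eigenvalues.
  The columns of \<open>S\<close> are eigenvectors, and a kernel vector of \<open>S\<close> would be
  a linear relation among them.\<close>

lemma diagonalize_distinct_spectrum:
  fixes X :: "'a :: field mat"
  assumes X: "X \<in> carrier_mat n n" and bij: "bij_betw a {..<n} (spectrum X)"
  obtains S T where "S \<in> carrier_mat n n" "T \<in> carrier_mat n n" "S * T = 1\<^sub>m n" "T * S = 1\<^sub>m n"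
    "X * S = S * mat_diag n a"
proof -
  have "\<exists>v. eigenvector X v (a i)" if "i < n" for i
    using bij_betwE[OF bij] that by (auto simp: spectrum_def eigenvalue_def)
  then obtain s where s: "\<And>i. i < n \<Longrightarrow> eigenvector X (s i) (a i)" by metis
  then have dim: "dim_vec (s i) = n" if "i < n" for i using that X by (auto simp: eigenvector_def)
  have inj: "inj_on a {..<n}" using bij by (rule bij_betw_imp_inj_on)
  define S where "S = mat n n (\<lambda>(k, i). s i $ k)"
  have S: "S \<in> carrier_mat n n" by (simp add: S_def)
  have det: "det S \<noteq> 0"
  proof
    assume "det S = 0"
    then obtain c where c: "c \<in> carrier_vec n" "c \<noteq> 0\<^sub>v n" "S *\<^sub>v c = 0\<^sub>v n"
      using det_0_iff_vec_prod_zero[OF S] by auto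
    have "(\<Sum>i<n. c $ i * s i $ k) = 0" if "k < n" for k
      using arg_cong[OF c(3), of "\<lambda>v. v $ k"] that c(1)
      by (simp add: S_def scalar_prod_def atLeast0LessThan mult.commute)
    then have "c $ i = 0" if "i < n" for i
      using distinct_eigenvectors_independent[OF X, of "{..<n}" s a "\<lambda>i. c $ i" i] s inj that by auto
    then have "c = 0\<^sub>v n" using c(1) by (intro eq_vecI) auto
    then show False using c(2) by simp
  qed
  have XS: "X * S = S * mat_diag n a"
  proof (rule eq_matI)
    fix k i assume "k < dim_row (S * mat_diag n a)" "i < dim_col (S * mat_diag n a)"
    then have ki: "k < n" "i < n" by (auto simp: S_def mat_diag_def)
    have "X *\<^sub>v s i = a i \<cdot>\<^sub>v s i" using s[OF ki(2)] by (simp add: eigenvector_def)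
    from arg_cong[OF this, of "\<lambda>v. v $ k"]
    show "(X * S) $$ (k, i) = (S * mat_diag n a) $$ (k, i)"
      using ki X dim by (simp add: mat_diag_mult_right[OF S])
        (simp add: S_def scalar_prod_def mult.commute)
  qed (use X in \<open>auto simp: S_def mat_diag_def\<close>)
  show thesis using that[OF S minv_inverse[OF S det] XS] .
qed

section \<open>Stein equations in eigenbases\<close>

lemma left_diagonalization:
  fixes A S S' :: "'a :: field mat"
  assumes A: "A \<in> carrier_mat n n"
    and S: "S \<in> carrier_mat n n" "S' \<in> carrier_mat n n" "S * S' = 1\<^sub>m n" "S' * S = 1\<^sub>m n"
    and AS: "A * S = S * mat_diag n a"
  shows "S' * A = mat_diag n a * S'"
proof -
  note ms = assoc_mult_mat[of _ n n _ n _ n] mult_carrier_mat[of _ n n _ n]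
  have "S' * A = S' * (A * S) * S'" using S A by (simp add: ms)
  also have "\<dots> = mat_diag n a * S'"
    unfolding AS using S by (simp add: ms mult_inverse_cancel[OF S(4,2,1)])
  finally show ?thesis .
qed

text \<open>The equations for \<open>P\<close> and \<open>Q\<close> involve transposes; this
  provides an eigenbasis of the transpose with the eigenvalues in the same order.\<close>

lemma transpose_diagonalization:
  fixes A S S' :: "'a :: field mat"
  assumes A: "A \<in> carrier_mat n n"
    and S: "S \<in> carrier_mat n n" "S' \<in> carrier_mat n n" "S * S' = 1\<^sub>m n" "S' * S = 1\<^sub>m n"
    and AS: "A * S = S * mat_diag n a"
  shows "transpose_mat A * transpose_mat S' = transpose_mat S' * mat_diag n a"
  using arg_cong[OF left_diagonalization[OF A S AS], of transpose_mat] S A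
  by (simp add: transpose_mult[of _ n n _ n])

text \<open>In the eigenbases \<open>Y = S' * X * T\<close> satisfies an equation in which entry
  \<open>(i, j)\<close> of \<open>Y\<close> is multiplied by \<open>1 - a i * b j\<close>, so it is
  solved by division. The general form with two matrices \<open>A\<close> and \<open>B\<close>
  covers all three Stein equations.\<close>

lemma stein_diagonalized:
  fixes A B X S S' T T' :: "'a :: field mat"
  assumes A: "A \<in> carrier_mat n n" and B: "B \<in> carrier_mat n n" and X: "X \<in> carrier_mat n n"
    and S: "S \<in> carrier_mat n n" "S' \<in> carrier_mat n n" "S * S' = 1\<^sub>m n" "S' * S = 1\<^sub>m n"
    and T: "T \<in> carrier_mat n n" "T' \<in> carrier_mat n n" "T * T' = 1\<^sub>m n" "T' * T = 1\<^sub>m n"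
    and AS: "A * S = S * mat_diag n a" and BT: "B * T = T * mat_diag n b"
    and v: "v \<in> carrier_vec n" and w: "w \<in> carrier_vec n"
    and stein: "X - A * X * B = outer v w"
    and ab: "\<And>i j. i < n \<Longrightarrow> j < n \<Longrightarrow> a i * b j \<noteq> 1"
  shows "X = S * (mat_diag n (\<lambda>i. (S' *\<^sub>v v) $ i) * mat n n (\<lambda>(i, j). 1 / (1 - a i * b j))
    * mat_diag n (\<lambda>i. (transpose_mat T *\<^sub>v w) $ i)) * T'"
    (is "X = S * (?Dx * ?H * ?Dy) * T'")
proof -
  note ms = assoc_mult_mat[of _ n n _ n _ n] mult_carrier_mat[of _ n n _ n]
  note cancel = mult_inverse_cancel[OF S(3,1,2)] mult_inverse_cancel[OF S(4,2,1)]
    mult_inverse_cancel[OF T(3,1,2)] mult_inverse_cancel[OF T(4,2,1)]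
  define Y where "Y = S' * X * T"
  have Y: "Y \<in> carrier_mat n n" using S T X by (simp add: Y_def ms)
  note SA = left_diagonalization[OF A S AS]
  have "Y - mat_diag n a * Y * mat_diag n b = S' * X * T - (mat_diag n a * S') * X * (T * mat_diag n b)"
    using S T X by (simp add: Y_def ms)
  also have "\<dots> = S' * (X - A * X * B) * T"
    unfolding SA[symmetric] BT[symmetric] using S T X A B
    by (simp add: ms mult_minus_distrib_mat[of _ n n _ n] minus_mult_distrib_mat[of _ n n _ _ n])
  finally have eq: "Y - mat_diag n a * Y * mat_diag n b = S' * outer v w * T" using stein by simp
  have "Y = ?Dx * ?H * ?Dy"
  proof (rule eq_matI)
    fix i j assume "i < dim_row (?Dx * ?H * ?Dy)" "j < dim_col (?Dx * ?H * ?Dy)"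
    then have ij: "i < n" "j < n" by (auto simp: mat_diag_def)
    have "(Y - mat_diag n a * Y * mat_diag n b) $$ (i, j) = Y $$ (i, j) * (1 - a i * b j)"
      using ij Y by (simp add: mat_diag_mult_left[of _ _ n] mat_diag_mult_right[of _ n] algebra_simps)
    moreover have "(S' * outer v w * T) $$ (i, j) = (S' *\<^sub>v v) $ i * (transpose_mat T *\<^sub>v w) $ j"
      using ij S T v w
      by (simp add: outer_def scalar_prod_def sum_distrib_left sum_distrib_right mult_ac)
    ultimately have "Y $$ (i, j) * (1 - a i * b j) = (S' *\<^sub>v v) $ i * (transpose_mat T *\<^sub>v w) $ j"
      using eq by simp
    then have "Y $$ (i, j) = (S' *\<^sub>v v) $ i * (transpose_mat T *\<^sub>v w) $ j / (1 - a i * b j)"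
      using ab[OF ij] by (simp add: field_simps)
    then show "Y $$ (i, j) = (?Dx * ?H * ?Dy) $$ (i, j)"
      using ij by (simp add: mat_diag_mult_left[of _ _ n] mat_diag_mult_right[of _ n])
  qed (use Y in \<open>auto simp: mat_diag_def\<close>)
  moreover have "X = S * Y * T'" using S T X by (simp add: Y_def ms cancel)
  ultimately show ?thesis by simp
qed

lemma mult_entry:
  fixes X Y :: "'a :: semiring_0 mat"
  assumes "X \<in> carrier_mat n n" "Y \<in> carrier_mat n n" "i < n" "j < n"
  shows "(X * Y) $$ (i, j) = (\<Sum>k<n. X $$ (i, k) * Y $$ (k, j))"
  using assms by (simp add: scalar_prod_def atLeast0LessThan)

subsection \<open>The Cauchy-type matrices\<close>

text \<open>Collects what the Stein data imply about the eigenvalues. No Cauchy determinant formula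
  enters: \<open>det_GA\<close> will come from the nonsingularity of \<open>P\<close>, and
  \<open>det_C\<close> from the invertibility of the change between the two eigenbases.\<close>

locale cauchy_pair =
  fixes n :: nat and a b :: "nat \<Rightarrow> complex"
  assumes inj_b: "inj_on b {..<n}"
    and aa: "\<And>i j. i < n \<Longrightarrow> j < n \<Longrightarrow> a i * a j \<noteq> 1"
    and bb: "\<And>i j. i < n \<Longrightarrow> j < n \<Longrightarrow> b i * b j \<noteq> 1"
    and ab: "\<And>i j. i < n \<Longrightarrow> j < n \<Longrightarrow> a i * b j \<noteq> 1"
    and disjoint: "\<And>i j. i < n \<Longrightarrow> j < n \<Longrightarrow> a i \<noteq> b j"
    and a_nonzero: "\<And>i. i < n \<Longrightarrow> a i \<noteq> 0"
    and b_nonzero: "\<And>i. i < n \<Longrightarrow> b i \<noteq> 0"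
    and det_GA: "det (GA_mat n a) \<noteq> 0"
    and det_C: "det (C_mat n a b) \<noteq> 0"
begin

abbreviation "G\<^sub>A \<equiv> GA_mat n a"
abbreviation "G\<^sub>B \<equiv> GB_mat n b"
abbreviation "H \<equiv> H_mat n a b"
abbreviation "C \<equiv> C_mat n a b"
abbreviation "\<Phi> \<equiv> Phi_mat n a b"
abbreviation "M \<equiv> M_mat n a b"
text \<open>The inverse of the diagonal matrix of the derivatives of the Blaschke product at its
  zeros.\<close>

abbreviation "D\<^sub>i \<equiv> mat_diag n (\<lambda>k. 1 / phi_B_deriv n b k)"

lemma carrier [simp]:
  "G\<^sub>A \<in> carrier_mat n n" "G\<^sub>B \<in> carrier_mat n n" "H \<in> carrier_mat n n" "C \<in> carrier_mat n n"
  "\<Phi> \<in> carrier_mat n n"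
  by (auto simp: GA_mat_def GB_mat_def H_mat_def C_mat_def Phi_mat_def)

lemmas assoc = assoc_mult_mat[of _ n n _ n _ n]
lemmas mult_carrier = mult_carrier_mat[of _ n n _ n]

text \<open>The Lagrange expansion evaluated at \<open>1 / b\<^sub>i\<close>.\<close>

lemma G\<^sub>B_mult: "G\<^sub>B * (D\<^sub>i * G\<^sub>B * D\<^sub>i) = 1\<^sub>m n"
proof (rule eq_matI)
  fix i j assume "i < dim_row (1\<^sub>m n :: complex mat)" "j < dim_col (1\<^sub>m n :: complex mat)"
  then have i: "i < n" and j: "j < n" by auto
  \<comment> \<open>Evaluation at \<open>1 / b i\<close> exchanges the two kinds of linear factors,
    up to one power of \<open>b i\<close> that is common to both sides.\<close>
  have scale: "(\<Prod>r\<in>J. 1 - b r * (1 / b i)) = (\<Prod>r\<in>J. b i - b r) / b i ^ card J"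
    "(\<Prod>r\<in>J. 1 / b i - b r) = (\<Prod>r\<in>J. 1 - b r * b i) / b i ^ card J" for J
    using b_nonzero[OF i] by (auto simp: prod_dividef[symmetric] field_simps simp flip: prod_constant)
  have card: "card ({..<n} - {k}) = n - 1" if "k < n" for k using that by simp
  let ?N = "\<Prod>r<n. 1 - b r * b i"
  have N: "?N \<noteq> 0" using bb i by auto
  have "(\<Prod>r\<in>{..<n} - {j}. b i - b r) / b i ^ (n - 1) = (\<Prod>r\<in>{..<n} - {j}. 1 - b r * (1 / b i))"
    unfolding scale card[OF j] ..
  also have "\<dots> = (\<Sum>k<n. 1 / (1 - b k * b j) / phi_B_deriv n b k * (\<Prod>r\<in>{..<n} - {k}. 1 / b i - b r))"
    by (rule lagrange_blaschke[OF inj_b bb j])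
  also have "\<dots> = (\<Sum>k<n. 1 / (1 - b k * b j) / phi_B_deriv n b k * (\<Prod>r\<in>{..<n} - {k}. 1 - b r * b i)) / b i ^ (n - 1)"
    unfolding scale sum_divide_distrib by (intro sum.cong) (simp_all add: card)
  finally have "(\<Prod>r\<in>{..<n} - {j}. b i - b r) =
      (\<Sum>k<n. 1 / (1 - b k * b j) / phi_B_deriv n b k * (\<Prod>r\<in>{..<n} - {k}. 1 - b r * b i))"
    using b_nonzero[OF i] by simp
  also have "\<dots> = (\<Sum>k<n. 1 / (1 - b k * b j) / phi_B_deriv n b k * (?N / (1 - b k * b i)))"
    using bb i by (intro sum.cong) (auto simp: prod_remove_eq_divide)
  also have "\<dots> = ?N * (\<Sum>k<n. 1 / (1 - b i * b k) * (1 / phi_B_deriv n b k) * (1 / (1 - b k * b j)))"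
    by (simp add: sum_distrib_left mult_ac)
  finally have "(\<Sum>k<n. 1 / (1 - b i * b k) * (1 / phi_B_deriv n b k) * (1 / (1 - b k * b j)))
      = (\<Prod>r\<in>{..<n} - {j}. b i - b r) / ?N"
    using N by (simp add: field_simps)
  \<comment> \<open>For distinct \<open>i\<close> and \<open>j\<close> the product contains the zero
    factor \<open>r = i\<close>; for \<open>i = j\<close> the quotient is the derivative
    itself.\<close>
  also have "\<dots> = (if i = j then phi_B_deriv n b j else 0)"
    using i j by (auto simp: phi_B_deriv_def intro!: prod_zero)
  finally have sum: "(\<Sum>k<n. 1 / (1 - b i * b k) * (1 / phi_B_deriv n b k) * (1 / (1 - b k * b j)))
      = (if i = j then phi_B_deriv n b j else 0)" .
  have "(G\<^sub>B * (D\<^sub>i * G\<^sub>B * D\<^sub>i)) $$ (i, j) =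
      (\<Sum>k<n. 1 / (1 - b i * b k) * (1 / phi_B_deriv n b k) * (1 / (1 - b k * b j))) / phi_B_deriv n b j"
    using i j
    by (simp add: mat_diag_mult_left[of _ _ n] mat_diag_mult_right[of _ n])
      (simp add: GB_mat_def scalar_prod_def atLeast0LessThan sum_divide_distrib mult_ac)
  also have "\<dots> = 1\<^sub>m n $$ (i, j)"
    unfolding sum using i j phi_B_deriv_nonzero[OF inj_b bb j] by simp
  finally show "(G\<^sub>B * (D\<^sub>i * G\<^sub>B * D\<^sub>i)) $$ (i, j) = 1\<^sub>m n $$ (i, j)" .
qed (auto simp: GB_mat_def mat_diag_def)

lemma minv_G\<^sub>B: "minv G\<^sub>B = D\<^sub>i * G\<^sub>B * D\<^sub>i"
  by (rule minv_eqI[OF _ _ G\<^sub>B_mult]) (simp_all add: mult_carrier)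

lemma det_G\<^sub>B: "det G\<^sub>B \<noteq> 0"
  by (rule det_nonzero_if_inverse[OF _ _ G\<^sub>B_mult]) (simp_all add: mult_carrier)

lemma transpose_G\<^sub>B: "transpose_mat G\<^sub>B = G\<^sub>B"
  by (auto simp: GB_mat_def mult.commute)

lemma transpose_\<Phi>: "transpose_mat \<Phi> = \<Phi>"
  by (simp add: Phi_mat_def)

lemma phi_B_a_nonzero: "i < n \<Longrightarrow> phi_B n b (a i) \<noteq> 0"
  using disjoint ab by (auto simp: phi_B_def mult.commute)

text \<open>The Lagrange expansion evaluated at \<open>a\<^sub>i\<close>.\<close>

lemma H_eq: "H = - (\<Phi> * C * D\<^sub>i * G\<^sub>B)"
proof (rule eq_matI)
  fix i j assume "i < dim_row (- (\<Phi> * C * D\<^sub>i * G\<^sub>B))" "j < dim_col (- (\<Phi> * C * D\<^sub>i * G\<^sub>B))"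
  then have i: "i < n" and j: "j < n" by (auto simp: GB_mat_def Phi_mat_def mat_diag_def)
  let ?N = "\<Prod>r<n. 1 - b r * a i"
  have ba: "b r * a i \<noteq> 1" if "r < n" for r using ab[OF i that] by (simp add: mult.commute)
  then have N: "?N \<noteq> 0" by auto
  have N': "(\<Prod>r<n. a i - b r) = phi_B n b (a i) * ?N"
    using N by (simp add: phi_B_def prod_dividef)
  have entry: "\<Phi> * C * D\<^sub>i =
      mat n n (\<lambda>(i, k). phi_B n b (a i) * (1 / (b k - a i)) * (1 / phi_B_deriv n b k))"
    unfolding Phi_mat_def mat_diag_mult_left[OF carrier(4)]
    by (subst mat_diag_mult_right[of _ n]) (auto simp: C_mat_def)
  \<comment> \<open>\<open>C\<close> is built from \<open>b k - a i\<close>, whereas interpolation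
    produces \<open>a i - b k\<close>; this is the origin of the minus sign in the claim.\<close>
  have neg: "z / (a i - b k) = - (z / (b k - a i))" for z k
    by (metis minus_diff_eq minus_divide_right)
  have "?N / (1 - b j * a i) = (\<Prod>r\<in>{..<n} - {j}. 1 - b r * a i)"
    using ba j by (simp add: prod_remove_eq_divide)
  also have "\<dots> = (\<Sum>k<n. 1 / (1 - b k * b j) / phi_B_deriv n b k * (\<Prod>r\<in>{..<n} - {k}. a i - b r))"
    by (rule lagrange_blaschke[OF inj_b bb j])
  also have "\<dots> = (\<Sum>k<n. 1 / (1 - b k * b j) / phi_B_deriv n b k * (phi_B n b (a i) * ?N / (a i - b k)))"
    unfolding N'[symmetric] using disjoint[OF i]
    by (intro sum.cong) (simp_all add: prod_remove_eq_divide)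
  also have "\<dots> = ?N * (\<Sum>k<n. phi_B n b (a i) / (a i - b k) / phi_B_deriv n b k / (1 - b k * b j))"
    by (simp add: sum_distrib_left mult_ac)
  finally have "?N * (1 / (1 - a i * b j)) =
      ?N * (\<Sum>k<n. phi_B n b (a i) / (a i - b k) / phi_B_deriv n b k / (1 - b k * b j))"
    by (simp add: mult.commute)
  then have "1 / (1 - a i * b j) =
      (\<Sum>k<n. phi_B n b (a i) / (a i - b k) / phi_B_deriv n b k / (1 - b k * b j))"
    unfolding mult_left_cancel[OF N] .
  also have "\<dots> = (\<Sum>k<n. - (phi_B n b (a i) * (1 / (b k - a i)) * (1 / phi_B_deriv n b k) * (1 / (1 - b k * b j))))"
    unfolding neg by (intro sum.cong) simp_all
  also have "\<dots> = - (\<Sum>k<n. phi_B n b (a i) * (1 / (b k - a i)) * (1 / phi_B_deriv n b k) * (1 / (1 - b k * b j)))"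
    by (rule sum_negf)
  also have "(\<Sum>k<n. phi_B n b (a i) * (1 / (b k - a i)) * (1 / phi_B_deriv n b k) * (1 / (1 - b k * b j))) =
      (\<Sum>k<n. (\<Phi> * C * D\<^sub>i) $$ (i, k) * G\<^sub>B $$ (k, j))"
    unfolding entry using i j by (intro sum.cong) (simp_all add: GB_mat_def)
  also have "\<dots> = (\<Phi> * C * D\<^sub>i * G\<^sub>B) $$ (i, j)"
    using i j by (subst mult_entry[of _ n]) (simp_all add: mult_carrier)
  finally have "1 / (1 - a i * b j) = - ((\<Phi> * C * D\<^sub>i * G\<^sub>B) $$ (i, j))" .
  moreover have "(- (\<Phi> * C * D\<^sub>i * G\<^sub>B)) $$ (i, j) = - ((\<Phi> * C * D\<^sub>i * G\<^sub>B) $$ (i, j))"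
    using i j carrier_matD[OF carrier(2)] carrier_matD[OF carrier(5)] by (intro index_uminus_mat) simp_all
  moreover have "H $$ (i, j) = 1 / (1 - a i * b j)" using i j by (simp add: H_mat_def)
  ultimately show "H $$ (i, j) = (- (\<Phi> * C * D\<^sub>i * G\<^sub>B)) $$ (i, j)" by simp
qed (auto simp: H_mat_def GB_mat_def Phi_mat_def mat_diag_def)

section \<open>Two expressions for the matrix \<open>M\<close>\<close>

lemma uminus_mult:
  assumes "X \<in> carrier_mat n n" "Y \<in> carrier_mat n n"
  shows "- X * Y = - (X * Y :: complex mat)" "X * - Y = - (X * Y)"
  using assms by auto

text \<open>Substituting \<open>H_eq\<close> into both factors of \<open>M\<close>, the signs
  cancel, and \<open>G\<^sub>B_mult\<close> collapses the middle to
  \<open>D\<^sub>i * G\<^sub>B * D\<^sub>i\<close>, which is the inverse of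
  \<open>G\<^sub>B\<close>.\<close>

lemma M_eq_C: "M = \<Phi> * C * minv G\<^sub>B * transpose_mat C * \<Phi>"
proof -
  have cancel: "G\<^sub>B * (D\<^sub>i * (G\<^sub>B * (D\<^sub>i * Z))) = Z" if "Z \<in> carrier_mat n n" for Z
    using mult_inverse_cancel[OF G\<^sub>B_mult _ _ that] that by (simp add: assoc mult_carrier)
  have t: "transpose_mat H = - (G\<^sub>B * (D\<^sub>i * (transpose_mat C * \<Phi>)))"
    unfolding H_eq
    by (simp add: transpose_uminus transpose_mult[of _ n n _ n] mult_carrier transpose_G\<^sub>B transpose_\<Phi>)
  show ?thesis
    unfolding M_mat_def t unfolding H_eq
    by (simp add: assoc mult_carrier cancel uminus_mult minv_G\<^sub>B)
qed

text \<open>Column \<open>j\<close> of \<open>minv G\<^sub>B * transpose_mat H\<close> solves the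
  linear system required of \<open>c\<close> in \<open>pick_expansion\<close> for
  \<open>u = a j\<close>. Multiplication by row \<open>i\<close> of \<open>H\<close> evaluates the
  resulting expansion at \<open>z = a i\<close>.\<close>

lemma M_eq_G\<^sub>A: "M = G\<^sub>A - \<Phi> * G\<^sub>A * \<Phi>"
proof (rule eq_matI)
  fix i j assume "i < dim_row (G\<^sub>A - \<Phi> * G\<^sub>A * \<Phi>)" "j < dim_col (G\<^sub>A - \<Phi> * G\<^sub>A * \<Phi>)"
  then have i: "i < n" and j: "j < n" by (auto simp: GA_mat_def Phi_mat_def mat_diag_def)
  note Gi = minv_inverse[OF carrier(2) det_G\<^sub>B]
  define X where "X = minv G\<^sub>B * transpose_mat H"
  have X: "X \<in> carrier_mat n n" using Gi by (simp add: X_def mult_carrier)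
  have GX: "G\<^sub>B * X = transpose_mat H" unfolding X_def using Gi by (simp add: mult_inverse_cancel)
  have "(\<Sum>k<n. X $$ (k, j) / (1 - b k * b l)) = 1 / (1 - a j * b l)" if l: "l < n" for l
    using arg_cong[OF GX, of "\<lambda>Z. Z $$ (l, j)"] l j X
    by (simp add: GB_mat_def H_mat_def scalar_prod_def atLeast0LessThan mult.commute)
  then have "(\<Sum>k<n. X $$ (k, j) / (1 - a i * b k)) =
      (1 - phi_B n b (a i) * phi_B n b (a j)) / (1 - a i * a j)"
    using i j a_nonzero ab aa by (intro pick_expansion[OF inj_b bb]) auto
  moreover have "M $$ (i, j) = (\<Sum>k<n. X $$ (k, j) / (1 - a i * b k))"
  proof -
    have "M = H * X" using Gi by (simp add: M_mat_def X_def assoc mult_carrier)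
    then show ?thesis using i j X
      by (simp add: H_mat_def scalar_prod_def atLeast0LessThan)
  qed
  ultimately show "M $$ (i, j) = (G\<^sub>A - \<Phi> * G\<^sub>A * \<Phi>) $$ (i, j)"
    using i j unfolding Phi_mat_def
    by (simp add: mat_diag_mult_left[of _ _ n] mat_diag_mult_right[of _ n] mult_carrier)
      (simp add: GA_mat_def diff_divide_distrib)
qed (auto simp: M_mat_def H_mat_def GA_mat_def Phi_mat_def mat_diag_def)

section \<open>The identities for \<open>L\<close> and \<open>K\<close>\<close>

lemma det_\<Phi>: "det \<Phi> \<noteq> 0"
  using phi_B_a_nonzero by (auto simp: Phi_mat_def det_mat_diag)

lemmas G\<^sub>A_inv = minv_inverse[OF carrier(1) det_GA]
lemmas G\<^sub>B_inv = minv_inverse[OF carrier(2) det_G\<^sub>B]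
lemmas C_inv = minv_inverse[OF carrier(4) det_C]
lemmas \<Phi>_inv = minv_inverse[OF carrier(5) det_\<Phi>]

lemma M_carrier [simp]: "M \<in> carrier_mat n n"
  using G\<^sub>B_inv(1) by (simp add: M_mat_def mult_carrier)

lemma det_minv_nonzero: "X \<in> carrier_mat n n \<Longrightarrow> det X \<noteq> 0 \<Longrightarrow> det (minv X :: complex mat) \<noteq> 0"
  using det_nonzero_if_inverse minv_inverse by blast

lemma det_M: "det M \<noteq> 0"
  unfolding M_eq_C using det_\<Phi> det_C det_minv_nonzero[OF _ det_G\<^sub>B] G\<^sub>B_inv(1)
  by (simp add: det_mult[of _ n] mult_carrier det_transpose[of _ n])

lemmas M_inv = minv_inverse[OF M_carrier det_M]

lemma L_eq_minv_M: "L_mat n a b = minv G\<^sub>A * M"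
  using G\<^sub>A_inv(1) G\<^sub>B_inv(1) by (simp add: L_mat_def M_mat_def assoc mult_carrier)

lemma L_eq: "L_mat n a b = 1\<^sub>m n - E_mat n a b"
  unfolding L_eq_minv_M M_eq_G\<^sub>A E_mat_def using G\<^sub>A_inv
  by (simp add: mult_minus_distrib_mat[of _ n n _ n] assoc mult_carrier)

text \<open>Inverting \<open>M_eq_C\<close> turns \<open>K\<close> into
  \<open>G\<^sub>A * \<Phi> * minv M * \<Phi>\<close>. Replacing \<open>G\<^sub>A\<close> on the
  right side by \<open>M + \<Phi> * G\<^sub>A * \<Phi>\<close> splits off the identity and leaves
  exactly this product.\<close>

lemma K_eq: "1\<^sub>m n + K_mat n a b = minv \<Phi> * (G\<^sub>A * minv M) * \<Phi>"
proof -
  have Ct: "transpose_mat (minv C) \<in> carrier_mat n n" "transpose_mat (minv C) * transpose_mat C = 1\<^sub>m n"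
    using C_inv transpose_mult[of C n n "minv C" n] by auto
  let ?Y = "transpose_mat (minv C) * G\<^sub>B * minv C"
  have Y: "?Y \<in> carrier_mat n n" using Ct C_inv by (simp add: mult_carrier)
  have "?Y * (minv \<Phi> * M) = \<Phi>"
    unfolding M_eq_C using C_inv Ct G\<^sub>B_inv \<Phi>_inv
    by (simp add: assoc mult_carrier mult_inverse_cancel[of _ _ n])
  then have "?Y * (minv \<Phi> * M) * (minv M * \<Phi>) = \<Phi> * (minv M * \<Phi>)" by simp
  moreover have "?Y * (minv \<Phi> * M) * (minv M * \<Phi>) = ?Y"
    using right_mult_one_mat[OF Y] Y M_inv \<Phi>_inv by (simp add: assoc mult_carrier mult_inverse_cancel[of _ _ n])
  ultimately have Y_eq: "?Y = \<Phi> * minv M * \<Phi>" using M_inv \<Phi>_inv by (simp add: assoc mult_carrier)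
  have "G\<^sub>A = M + \<Phi> * G\<^sub>A * \<Phi>"
    unfolding M_eq_G\<^sub>A by (rule eq_matI) (auto simp: Phi_mat_def mat_diag_def GA_mat_def)
  then have "minv \<Phi> * (G\<^sub>A * minv M) * \<Phi> = minv \<Phi> * ((M + \<Phi> * G\<^sub>A * \<Phi>) * minv M) * \<Phi>" by simp
  also have "\<dots> = 1\<^sub>m n + G\<^sub>A * (\<Phi> * minv M * \<Phi>)"
    using M_inv \<Phi>_inv
    by (simp add: assoc mult_carrier mult_inverse_cancel[of _ _ n]
        mult_add_distrib_mat[of _ n n _ n] add_mult_distrib_mat[of _ n n _ _ n])
  also have "\<dots> = 1\<^sub>m n + K_mat n a b"
    unfolding Y_eq[symmetric] using Ct C_inv by (simp add: K_mat_def assoc mult_carrier)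
  finally show ?thesis by simp
qed

lemma K_carrier: "K_mat n a b \<in> carrier_mat n n"
  using C_inv(1) by (simp add: K_mat_def mult_carrier)

lemma det_K: "det (1\<^sub>m n + K_mat n a b) \<noteq> 0"
  unfolding K_eq using det_\<Phi> det_GA det_minv_nonzero[OF _ det_M] det_minv_nonzero[OF _ det_\<Phi>] M_inv(1) \<Phi>_inv(1)
  by (simp add: det_mult[of _ n] mult_carrier)

lemma minv_K: "minv (1\<^sub>m n + K_mat n a b) = minv \<Phi> * M * minv G\<^sub>A * \<Phi>"
  unfolding K_eq using M_inv \<Phi>_inv G\<^sub>A_inv
  by (intro minv_eqI) (simp_all add: assoc mult_carrier mult_inverse_cancel[of _ _ n])

text \<open>Conjugating \<open>minv G\<^sub>A * M\<close> by \<open>minv \<Phi> * G\<^sub>A\<close>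
  moves \<open>minv G\<^sub>A\<close> behind \<open>M\<close> and adds the outer factors
  \<open>minv \<Phi>\<close> and \<open>\<Phi>\<close>.\<close>

lemma similar_minv_K: "similar_mat (minv (1\<^sub>m n + K_mat n a b)) (L_mat n a b)"
proof (rule similar_matI[of _ _ "minv \<Phi> * G\<^sub>A" "minv G\<^sub>A * \<Phi>" n])
  show "minv (1\<^sub>m n + K_mat n a b) = minv \<Phi> * G\<^sub>A * L_mat n a b * (minv G\<^sub>A * \<Phi>)"
    unfolding minv_K L_eq_minv_M using M_inv \<Phi>_inv G\<^sub>A_inv
    by (simp add: assoc mult_carrier mult_inverse_cancel[of _ _ n])
  show "{minv (1\<^sub>m n + K_mat n a b), L_mat n a b, minv \<Phi> * G\<^sub>A, minv G\<^sub>A * \<Phi>} \<subseteq> carrier_mat n n"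
    unfolding minv_K L_eq_minv_M using M_inv \<Phi>_inv G\<^sub>A_inv by (simp add: mult_carrier)
qed (use \<Phi>_inv G\<^sub>A_inv in \<open>simp_all add: assoc mult_carrier mult_inverse_cancel[of _ _ n]\<close>)

end

subsection \<open>Reduction of the Stein solutions to Cauchy-type matrices\<close>

lemma similar_mat_minv:
  fixes X Y :: "'a :: field mat"
  assumes sim: "similar_mat X Y" and det: "det X \<noteq> 0"
  shows "similar_mat (minv X) (minv Y)"
proof -
  from similar_matD[OF sim] obtain n S T where
    car: "{X, Y, S, T} \<subseteq> carrier_mat n n" and
    inv: "S * T = 1\<^sub>m n" "T * S = 1\<^sub>m n" and X: "X = S * Y * T" by blast
  have c: "X \<in> carrier_mat n n" "Y \<in> carrier_mat n n" "S \<in> carrier_mat n n" "T \<in> carrier_mat n n"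
    using car by auto
  have detY: "det Y \<noteq> 0" using det det_similar[OF sim] by simp
  note Y = minv_inverse[OF c(2) detY]
  have eq: "minv X = S * minv Y * T"
    unfolding X using c Y inv
    by (intro minv_eqI[of _ n])
      (simp_all add: assoc_mult_mat[of _ n n _ n _ n] mult_carrier_mat[of _ n n _ n] mult_inverse_cancel[of _ _ n])
  show ?thesis
    using c Y inv eq minv_inverse(1)[OF c(1) det]
    by (intro similar_matI[of _ _ S T n]) auto
qed

text \<open>The conclusions share one proof because they rest on the same eigenbases and the same
  diagonal weights, the coordinates \<open>x\<close> and \<open>y\<close> of \<open>v\<close> and
  \<open>w\<close>.\<close>

lemma stein_complex:
  fixes A B P Q R :: "complex mat"
  assumes A: "A \<in> carrier_mat n n"
    and v: "v \<in> carrier_vec n"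
    and w: "w \<in> carrier_vec n"
    and B: "B = A + outer v w"
    and aa: "\<And>i j. i < n \<Longrightarrow> j < n \<Longrightarrow> a i * a j \<noteq> 1"
    and bb: "\<And>i j. i < n \<Longrightarrow> j < n \<Longrightarrow> b i * b j \<noteq> 1"
    and ab: "\<And>i j. i < n \<Longrightarrow> j < n \<Longrightarrow> a i * b j \<noteq> 1"
    and P: "P \<in> carrier_mat n n" "P - A * P * transpose_mat A = outer v v"
    and Q: "Q \<in> carrier_mat n n" "Q - transpose_mat B * Q * B = outer w w"
    and R: "R \<in> carrier_mat n n" "R - A * R * B = outer v w"
    and S1: "0 \<notin> spectrum A" "0 \<notin> spectrum B"
    and S2: "det P \<noteq> 0" "det Q \<noteq> 0"
    and a: "bij_betw a {..<n} (spectrum A)"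
    and b: "bij_betw b {..<n} (spectrum B)"
  shows "cauchy_pair n a b"
    and "similar_mat (minv P * R * minv Q * transpose_mat R) (L_mat n a b)"
    and "similar_mat (1\<^sub>m n + P * Q) (1\<^sub>m n + K_mat n a b)"
proof -
  note ms = assoc_mult_mat[of _ n n _ n _ n] mult_carrier_mat[of _ n n _ n]
  have Bc: "B \<in> carrier_mat n n" using A v w by (auto simp: B outer_def)
  obtain S S' where S: "S \<in> carrier_mat n n" "S' \<in> carrier_mat n n" "S * S' = 1\<^sub>m n" "S' * S = 1\<^sub>m n"
    and AS: "A * S = S * mat_diag n a" using diagonalize_distinct_spectrum[OF A a] .
  obtain T T' where T: "T \<in> carrier_mat n n" "T' \<in> carrier_mat n n" "T * T' = 1\<^sub>m n" "T' * T = 1\<^sub>m n"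
    and BT: "B * T = T * mat_diag n b" using diagonalize_distinct_spectrum[OF Bc b] .
  have St: "transpose_mat S \<in> carrier_mat n n" "transpose_mat S' \<in> carrier_mat n n"
    "transpose_mat S * transpose_mat S' = 1\<^sub>m n" "transpose_mat S' * transpose_mat S = 1\<^sub>m n"
    using S transpose_mult[OF S(1,2), symmetric] transpose_mult[OF S(2,1), symmetric] by auto
  have Tt: "transpose_mat T \<in> carrier_mat n n" "transpose_mat T' \<in> carrier_mat n n"
    "transpose_mat T * transpose_mat T' = 1\<^sub>m n" "transpose_mat T' * transpose_mat T = 1\<^sub>m n"
    using T transpose_mult[OF T(1,2), symmetric] transpose_mult[OF T(2,1), symmetric] by auto
  define x where "x i = (S' *\<^sub>v v) $ i" for i
  define y where "y i = (transpose_mat T *\<^sub>v w) $ i" for i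
  define Dx where "Dx = mat_diag n x"
  define Dy where "Dy = mat_diag n y"
  let ?GA = "GA_mat n a" and ?GB = "GB_mat n b" and ?H = "H_mat n a b" and ?C = "C_mat n a b"
  have D: "Dx \<in> carrier_mat n n" "Dy \<in> carrier_mat n n" by (simp_all add: Dx_def Dy_def)
  have G: "?GA \<in> carrier_mat n n" "?GB \<in> carrier_mat n n" "?H \<in> carrier_mat n n" "?C \<in> carrier_mat n n"
    by (simp_all add: GA_mat_def GB_mat_def H_mat_def C_mat_def)
  have P_eq: "P = S * (Dx * ?GA * Dx) * transpose_mat S"
    using stein_diagonalized[OF A _ P(1) S St(2,1,4,3) AS transpose_diagonalization[OF A S AS] v v P(2) aa] A
    by (simp add: Dx_def x_def[abs_def] GA_mat_def)
  have Q_eq: "Q = transpose_mat T' * (Dy * ?GB * Dy) * T'"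
    using stein_diagonalized[OF _ Bc Q(1) Tt(2,1,4,3) T transpose_diagonalization[OF Bc T BT] BT w w Q(2) bb] Bc
    by (simp add: Dy_def y_def[abs_def] GB_mat_def)
  have R_eq: "R = S * (Dx * ?H * Dy) * T'"
    using stein_diagonalized[OF A Bc R(1) S T AS BT v w R(2) ab]
    by (simp add: Dx_def Dy_def x_def[abs_def] y_def[abs_def] H_mat_def)
  \<comment> \<open>Nonsingularity of \<open>P\<close> and \<open>Q\<close> passes to every factor;
    in particular no coordinate of \<open>v\<close> or \<open>w\<close> vanishes.\<close>
  have detP: "det Dx \<noteq> 0" "det ?GA \<noteq> 0"
    using S2(1) unfolding P_eq using S D G St by (auto simp: det_mult[of _ n] ms)
  have detQ: "det Dy \<noteq> 0" "det ?GB \<noteq> 0"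
    using S2(2) unfolding Q_eq using T D G Tt by (auto simp: det_mult[of _ n] ms)
  have x0: "x i \<noteq> 0" if "i < n" for i using detP that by (auto simp: Dx_def det_mat_diag)
  have y0: "y i \<noteq> 0" if "i < n" for i using detQ that by (auto simp: Dy_def det_mat_diag)
  define W where "W = S' * T"
  have W: "W \<in> carrier_mat n n" using S T by (simp add: W_def ms)
  \<comment> \<open>Conjugating \<open>B = A + outer v w\<close> into the two eigenbases gives a
    Sylvester equation for \<open>W\<close>, read here entry by entry.\<close>
  have W_entry: "W $$ (i, j) * (b j - a i) = x i * y j" if ij: "i < n" "j < n" for i j
  proof -
    have O: "outer v w \<in> carrier_mat n n" using v w by (auto simp: outer_def)
    note SA = left_diagonalization[OF A S AS]
    have "W * mat_diag n b = S' * (B * T)" unfolding BT W_def using S T by (simp add: ms)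
    also have "\<dots> = S' * A * T + S' * outer v w * T"
      unfolding B using S T A O
      by (simp add: ms mult_add_distrib_mat[of _ n n _ n] add_mult_distrib_mat[of _ n n _ _ n])
    also have "\<dots> = mat_diag n a * W + S' * outer v w * T"
      unfolding SA using S T by (simp add: W_def ms)
    finally have "(W * mat_diag n b) $$ (i, j) = (mat_diag n a * W + S' * outer v w * T) $$ (i, j)" by simp
    moreover have "(S' * outer v w * T) $$ (i, j) = x i * y j"
      unfolding x_def y_def using ij S T v w
      by (simp add: outer_def scalar_prod_def sum_distrib_left sum_distrib_right mult_ac)
    ultimately show ?thesis
      using ij W S T O
      by (simp add: mat_diag_mult_left[OF W] mat_diag_mult_right[OF W] algebra_simps)
  qed
  \<comment> \<open>A common eigenvalue would annihilate the left side of \<open>W_entry\<close>,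
    but \<open>x i * y j\<close> is nonzero.\<close>
  have disj: "a i \<noteq> b j" if "i < n" "j < n" for i j
    using W_entry[OF that] x0 y0 that by auto
  have W_eq: "W = Dx * ?C * Dy"
  proof (rule eq_matI)
    fix i j assume "i < dim_row (Dx * ?C * Dy)" "j < dim_col (Dx * ?C * Dy)"
    then have ij: "i < n" "j < n" using D by auto
    have "W $$ (i, j) = x i * y j / (b j - a i)"
      using W_entry[OF ij] disj[OF ij] by (simp add: field_simps)
    then show "W $$ (i, j) = (Dx * ?C * Dy) $$ (i, j)"
      using ij unfolding Dx_def Dy_def C_mat_def
      by (simp add: mat_diag_mult_left[of _ _ n] mat_diag_mult_right[of _ n])
  qed (use W D in auto)
  define W' where "W' = T' * S"
  have W': "W' \<in> carrier_mat n n" "W * W' = 1\<^sub>m n" "W' * W = 1\<^sub>m n"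
    using S T by (simp_all add: W_def W'_def ms mult_inverse_cancel[of _ _ n])
  have "det W \<noteq> 0" by (rule det_nonzero_if_inverse[OF W W'(1,2)])
  then have detC: "det ?C \<noteq> 0" unfolding W_eq using D G by (auto simp: det_mult[of _ n] ms)
  have a0: "a i \<noteq> 0" and b0: "b i \<noteq> 0" if "i < n" for i
    using S1 bij_betwE[OF a] bij_betwE[OF b] that by (metis lessThan_iff)+
  show cp: "cauchy_pair n a b"
    by unfold_locales (use aa bb ab disj a0 b0 detP detC bij_betw_imp_inj_on[OF b] in auto)
  define Ex where "Ex = minv Dx"
  define Ey where "Ey = minv Dy"
  note Ex = minv_inverse[OF D(1) detP(1), folded Ex_def]
  note Ey = minv_inverse[OF D(2) detQ(1), folded Ey_def]
  note GAi = minv_inverse[OF G(1) detP(2)]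
  note GBi = minv_inverse[OF G(2) detQ(2)]
  note Ci = minv_inverse[OF G(4) detC]
  note cancel = mult_inverse_cancel[of _ _ n]
  have Dt: "transpose_mat Dx = Dx" "transpose_mat Dy = Dy" by (simp_all add: Dx_def Dy_def)
  have minvP: "minv P = transpose_mat S' * Ex * minv ?GA * Ex * S'"
    by (rule minv_eqI[OF P(1)])
      (use S St D G Ex GAi in \<open>simp_all add: P_eq ms cancel\<close>)
  have minvQ: "minv Q = T * Ey * minv ?GB * Ey * transpose_mat T"
    by (rule minv_eqI[OF Q(1)])
      (use T Tt D G Ey GBi in \<open>simp_all add: Q_eq ms cancel\<close>)
  have Rt: "transpose_mat R = transpose_mat T' * Dy * transpose_mat ?H * Dx * transpose_mat S"
    unfolding R_eq using S T D G by (simp add: transpose_mult[of _ n n _ n] ms Dt)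
  have Ht: "transpose_mat ?H \<in> carrier_mat n n" using G by simp
  \<comment> \<open>The basis change \<open>T\<close> and the weights \<open>Dy\<close> cancel in
    the middle; only a conjugation by \<open>transpose_mat S' * Ex\<close> remains.\<close>
  have L: "minv P * R * minv Q * transpose_mat R =
      transpose_mat S' * Ex * L_mat n a b * (Dx * transpose_mat S)"
    unfolding minvP minvQ Rt unfolding R_eq L_mat_def
    using S T St Tt D G Ht Ex Ey GAi GBi by (simp add: ms cancel)
  show "similar_mat (minv P * R * minv Q * transpose_mat R) (L_mat n a b)"
  proof (rule similar_matI[OF _ _ _ L])
    show "{minv P * R * minv Q * transpose_mat R, L_mat n a b, transpose_mat S' * Ex, Dx * transpose_mat S}
        \<subseteq> carrier_mat n n"
      unfolding L unfolding L_mat_def using S St D G Ht Ex GAi GBi by (simp add: ms)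
  qed (use S St D Ex in \<open>simp_all add: ms cancel\<close>)
  have W'_eq: "W' = Ey * minv ?C * Ex"
  proof -
    have "W * (Ey * minv ?C * Ex) = 1\<^sub>m n"
      unfolding W_eq using D G Ci Ex Ey by (simp add: ms cancel)
    moreover have "W' * (W * (Ey * minv ?C * Ex)) = Ey * minv ?C * Ex"
      using W W' Ci Ex Ey by (intro mult_inverse_cancel) (auto simp: ms)
    ultimately show ?thesis using W' by simp
  qed
  \<comment> \<open>Writing \<open>T'\<close> through \<open>S'\<close> and \<open>minv ?C\<close>
    leaves a single eigenbasis in \<open>P * Q\<close>, so that \<open>K\<close> appears conjugated
    by \<open>S * Dx\<close>.\<close>
  have T'_eq: "T' = Ey * minv ?C * Ex * S'"
  proof -
    have "T' = W' * S'" using S T by (simp add: W'_def ms cancel)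
    then show ?thesis by (simp add: W'_eq)
  qed
  have Et: "transpose_mat Ex = Ex" "transpose_mat Ey = Ey"
  proof -
    have "Dx * transpose_mat Ex = 1\<^sub>m n" "Dy * transpose_mat Ey = 1\<^sub>m n"
      using transpose_mult[OF Ex(1) D(1), symmetric] transpose_mult[OF Ey(1) D(2), symmetric] Ex Ey by (simp_all add: Dt)
    then show "transpose_mat Ex = Ex" "transpose_mat Ey = Ey"
      using minv_eqI[OF D(1), of "transpose_mat Ex"] minv_eqI[OF D(2), of "transpose_mat Ey"] Ex Ey
      by (simp_all add: Ex_def Ey_def)
  qed
  have Cit: "transpose_mat (minv ?C) \<in> carrier_mat n n" using Ci by simp
  have T't: "transpose_mat T' = transpose_mat S' * Ex * transpose_mat (minv ?C) * Ey"
    unfolding T'_eq using S Ci Ex Ey by (simp add: transpose_mult[of _ n n _ n] ms Et)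
  have PQ: "P * Q = S * Dx * K_mat n a b * (Ex * S')"
    unfolding P_eq Q_eq T't unfolding T'_eq K_mat_def
    using S St D G Ex Ey Ci Cit by (simp add: ms cancel)
  have K: "K_mat n a b \<in> carrier_mat n n" unfolding K_mat_def using G Ci Cit by (simp add: ms)
  show "similar_mat (1\<^sub>m n + P * Q) (1\<^sub>m n + K_mat n a b)"
  proof (rule similar_matI[of _ _ "S * Dx" "Ex * S'" n])
    show "1\<^sub>m n + P * Q = S * Dx * (1\<^sub>m n + K_mat n a b) * (Ex * S')"
      unfolding PQ using S D Ex K
      by (simp add: ms cancel mult_add_distrib_mat[of _ n n _ n] add_mult_distrib_mat[of _ n n _ _ n])
  qed (use P Q K S D Ex in \<open>simp_all add: ms cancel\<close>)
qed

section \<open>Passage between real and complex matrices\<close>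

lemma cmat_transpose: "cmat (transpose_mat X) = transpose_mat (cmat X)"
  by auto

lemma cmat_outer: "cmat (outer v w) = outer (map_vec complex_of_real v) (map_vec complex_of_real w)"
  by (auto simp: outer_def)

lemma cmat_minv:
  assumes X: "X \<in> carrier_mat n n" and det: "det X \<noteq> 0"
  shows "cmat (minv X) = minv (cmat X)"
proof -
  note inv = minv_inverse[OF X det]
  have "cmat X * cmat (minv X) = 1\<^sub>m n"
    using of_real_hom.mat_hom_mult[OF X inv(1), symmetric] inv(2) by (simp add: of_real_hom.mat_hom_one)
  then show ?thesis using minv_eqI[of "cmat X" n "cmat (minv X)"] X inv(1) by simp
qed

lemma cmat_minus:
  assumes "X \<in> carrier_mat n m" "Y \<in> carrier_mat n m"
  shows "cmat (X - Y) = cmat X - cmat Y"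
  using assms by auto

lemma cmat_add:
  assumes "X \<in> carrier_mat n m" "Y \<in> carrier_mat n m"
  shows "cmat (X + Y) = cmat X + cmat Y"
  using assms by auto

theorem proposition5p1:
  fixes n :: nat
    and A B P Q R :: "real mat"
    and v w :: "real vec"
    and a b :: "nat \<Rightarrow> complex"
  assumes A: "A \<in> carrier_mat n n"
    and v: "v \<in> carrier_vec n"
    and w: "w \<in> carrier_vec n"
    and B: "B = A + outer v w"
    and nonres: "nonresonant A B"
    and P: "P \<in> carrier_mat n n" "P - A * P * transpose_mat A = outer v v"
    and Q: "Q \<in> carrier_mat n n" "Q - transpose_mat B * Q * B = outer w w"
    and R: "R \<in> carrier_mat n n" "R - A * R * B = outer v w"
    and S1_A: "card (spectrum (cmat A)) = n" "0 \<notin> spectrum (cmat A)"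
    and S1_B: "card (spectrum (cmat B)) = n" "0 \<notin> spectrum (cmat B)"
    and S2: "invertible_mat P" "invertible_mat Q"
    and a: "bij_betw a {..<n} (spectrum (cmat A))"
    and b: "bij_betw b {..<n} (spectrum (cmat B))"
  shows "L_mat n a b = 1\<^sub>m n - E_mat n a b
    \<and> 1\<^sub>m n + K_mat n a b =
        minv (Phi_mat n a b) * (GA_mat n a * minv (M_mat n a b)) * Phi_mat n a b
    \<and> invertible_mat (1\<^sub>m n + K_mat n a b)
    \<and> invertible_mat (1\<^sub>m n + P * Q)
    \<and> similar_mat (cmat (minv P * R * minv Q * transpose_mat R)) (1\<^sub>m n - E_mat n a b)
    \<and> similar_mat (cmat (minv (1\<^sub>m n + P * Q))) (1\<^sub>m n - E_mat n a b)
    \<and> similar_mat (cmat (minv P * R * minv Q * transpose_mat R)) (cmat (minv (1\<^sub>m n + P * Q)))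
    \<and> similar_mat (minv P * R * minv Q * transpose_mat R) (minv (1\<^sub>m n + P * Q))
    \<and> char_poly (minv P * R * minv Q * transpose_mat R) = char_poly (minv (1\<^sub>m n + P * Q))"
proof -
  note hom_mult = of_real_hom.mat_hom_mult[of _ n n _ n]
  note cm = hom_mult cmat_transpose cmat_outer cmat_minus[of _ n n] cmat_add[of _ n n]
    of_real_hom.mat_hom_one mult_carrier_mat[of _ n n _ n]
  have O: "outer v w \<in> carrier_mat n n" using v w by (auto simp: outer_def)
  have Bc: "B \<in> carrier_mat n n" using A O by (simp add: B)
  have detP: "det P \<noteq> 0" and detQ: "det Q \<noteq> 0"
    using S2 invertible_mat_iff_det P(1) Q(1) by auto
  have aS: "a i \<in> spectrum (cmat A)" and bS: "b i \<in> spectrum (cmat B)" if "i < n" for i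
    using bij_betwE[OF a] bij_betwE[OF b] that by auto
  have Bc': "cmat B = cmat A + outer (map_vec complex_of_real v) (map_vec complex_of_real w)"
    unfolding B using A O by (simp add: cm)
  have P': "cmat P - cmat A * cmat P * transpose_mat (cmat A) =
      outer (map_vec complex_of_real v) (map_vec complex_of_real v)"
    using arg_cong[OF P(2), of cmat] A P(1) by (simp add: cm)
  have Q': "cmat Q - transpose_mat (cmat B) * cmat Q * cmat B =
      outer (map_vec complex_of_real w) (map_vec complex_of_real w)"
    using arg_cong[OF Q(2), of cmat] Bc Q(1) by (simp add: cm)
  have R': "cmat R - cmat A * cmat R * cmat B =
      outer (map_vec complex_of_real v) (map_vec complex_of_real w)"
    using arg_cong[OF R(2), of cmat] A Bc R(1) by (simp add: cm)
  have nr: "a i * a j \<noteq> 1" "b i * b j \<noteq> 1" "a i * b j \<noteq> 1" if "i < n" "j < n" for i j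
    using nonres aS bS that unfolding nonresonant_def by blast+
  have car: "cmat A \<in> carrier_mat n n" "cmat P \<in> carrier_mat n n" "cmat Q \<in> carrier_mat n n"
    "cmat R \<in> carrier_mat n n" "map_vec complex_of_real v \<in> carrier_vec n"
    "map_vec complex_of_real w \<in> carrier_vec n"
    using A P(1) Q(1) R(1) v w by simp_all
  have dets: "det (cmat P) \<noteq> 0" "det (cmat Q) \<noteq> 0" using detP detQ by simp_all
  note complex = stein_complex[of "cmat A" n "map_vec complex_of_real v" "map_vec complex_of_real w"
      "cmat B" a b "cmat P" "cmat Q" "cmat R", OF car(1,5,6) Bc' _ _ _ car(2) P' car(3) Q' car(4) R'
      S1_A(2) S1_B(2) dets a b]
  interpret cauchy_pair n a b
    by (rule complex(1)) (rule nr; assumption)+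
  note Pi = minv_inverse[OF P(1) detP] and Qi = minv_inverse[OF Q(1) detQ]
  let ?X = "minv P * R * minv Q * transpose_mat R"
  have "cmat ?X = minv (cmat P) * cmat R * minv (cmat Q) * transpose_mat (cmat R)"
    unfolding cmat_minv[OF P(1) detP, symmetric] cmat_minv[OF Q(1) detQ, symmetric]
    using R(1) Pi(1) Qi(1) by (simp add: cm)
  then have simL: "similar_mat (cmat ?X) (1\<^sub>m n - E_mat n a b)"
    using complex(2)[OF nr(1) nr(2) nr(3)] by (simp add: L_eq)
  have PQ: "1\<^sub>m n + P * Q \<in> carrier_mat n n" using P(1) Q(1) by simp
  have "cmat (1\<^sub>m n + P * Q) = 1\<^sub>m n + cmat P * cmat Q" using P(1) Q(1) by (simp add: cm)
  then have simK: "similar_mat (cmat (1\<^sub>m n + P * Q)) (1\<^sub>m n + K_mat n a b)"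
    using complex(3)[OF nr(1) nr(2) nr(3)] by simp
  \<comment> \<open>The similarity carries nonsingularity from
    \<open>1\<^sub>m n + K_mat n a b\<close> to the complexified matrix, and \<open>cmat\<close>
    commutes with the determinant.\<close>
  have det': "det (cmat (1\<^sub>m n + P * Q)) \<noteq> 0" using det_similar[OF simK] det_K by simp
  then have det: "det (1\<^sub>m n + P * Q) \<noteq> 0" by simp
  have simM: "similar_mat (cmat (minv (1\<^sub>m n + P * Q))) (1\<^sub>m n - E_mat n a b)"
    unfolding cmat_minv[OF PQ det] L_eq[symmetric]
    by (rule similar_mat_trans[OF similar_mat_minv[OF simK det'] similar_minv_K])
  have simC: "similar_mat (cmat ?X) (cmat (minv (1\<^sub>m n + P * Q)))"
    by (rule similar_mat_trans_sym[OF simL simM])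
  note simR = similar_mat_real_if_complex[OF simC]
  have "invertible_mat (1\<^sub>m n + K_mat n a b)"
    using invertible_mat_iff_det[of "1\<^sub>m n + K_mat n a b" n] K_carrier det_K by simp
  moreover have "invertible_mat (1\<^sub>m n + P * Q)"
    using invertible_mat_iff_det[OF PQ] det by simp
  ultimately show ?thesis
    using L_eq K_eq simL simM simC simR char_poly_similar[OF simR] by blast
qed

end
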